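(* Let $(\mathcal{X},d)$ be a finite metric space, $p\ge 1$ and $C>0$. Then: (i) $\mathrm{KR}_{p,C}$ defines a metric on the set $\mathcal{M}_+(\mathcal{X})$ of non-negative measures on $\mathcal{X}$. (ii) If $C\le\min_{x\ne x'}d(x,x')$, then for all $\mu,\nu\in\mathcal{M}_+(\mathcal{X})$ $$\mathrm{KR}_{p,C}^p(\mu,\nu)=\frac{C^p}{2}\,\mathrm{TV}(\mu,\nu),\qquad \mathrm{TV}(\mu,\nu):=\sum_{x\in\mathcal{X}}|\mu(x)-\nu(x)|.$$ The same equality holds for all $C>0$ if $\mu(x)\ge\nu(x)$ for all $x\in\mathcal{X}$ or if $\mu(x)\le\nu(x)$ for all $x\in\mathcal{X}$. (iii) If $C\ge\max_{x,x'}d(x,x')$ and $\mu,\nu\in\mathcal{M}_+(\mathcal{X})$ satisfy $\mathbb{M}(\mu)=\mathbb{M}(\nu)$, then $$\mathrm{KR}_{p,C}^p(\mu,\nu)=W_p^p(\mu,\nu).$$ (iv) If $0<C_1\le C_2$, then for all $\mu,\nu\in\mathcal{M}_+(\mathcal{X})$ $$\mathrm{KR}_{p,C_1}^p(\mu,\nu)\le\mathrm{KR}_{p,C_2}^p(\mu,\nu).$$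
   Context: A non-negative measure on the finite set $\mathcal{X}$ is a function $\mu:\mathcal{X}\to[0,\infty)$, with total mass $\mathbb{M}(\mu)=\sum_{x}\mu(x)$. For $\pi\in\mathcal{M}_+(\mathcal{X}\times\mathcal{X})$ put $\pi(x,\mathcal{X})=\sum_{x'}\pi(x,x')$ and $\pi(\mathcal{X},x')=\sum_{x}\pi(x,x')$. Let $$\Pi_{\le}(\mu,\nu)=\{\pi\in\mathcal{M}_+(\mathcal{X}\times\mathcal{X}) : \pi(x,\mathcal{X})\le\mu(x),\ \pi(\mathcal{X},x')\le\nu(x')\ \ \forall x,x'\},$$ and let $\Pi_{=}(\mu,\nu)$ be the analogous set with equalities in place of inequalities. Define $$\mathrm{UOT}_{p,C}(\mu,\nu)=\min_{\pi\in\Pi_{\le}(\mu,\nu)}\sum_{x,x'}d^p(x,x')\pi(x,x')+C^p\left(\frac{\mathbb{M}(\mu)+\mathbb{M}(\nu)}{2}-\mathbb{M}(\pi)\right),$$ the $p$-th order Kantorovich-Rubinstein distance $\mathrm{KR}_{p,C}(\mu,\nu)=(\mathrm{UOT}_{p,C}(\mu,\nu))^{1/p}$, and, for $\mathbb{M}(\mu)=\mathbb{M}(\nu)$, the $p$-Wasserstein distance $W_p(\mu,\nu)=\big(\min_{\pi\in\Pi_{=}(\mu,\nu)}\sum_{x,x'}d^p(x,x')\pi(x,x')\big)^{1/p}$. *)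

theory Defs
  imports "HOL-Analysis.Analysis"
begin

text \<open>
  A non-negative measure on a finite carrier set is a function into \<open>[0,\<infinity>)\<close>. It is taken to be
  extensional (equal to \<^const>\<open>undefined\<close> off the carrier), so that equality of measures is
  pointwise equality on the carrier.
\<close>

definition nonneg_measures :: "'a set \<Rightarrow> ('a \<Rightarrow> real) set" where
  "nonneg_measures S = S \<rightarrow>\<^sub>E {0..}"

definition mass :: "'a set \<Rightarrow> ('a \<Rightarrow> real) \<Rightarrow> real" where
  "mass S \<mu> = (\<Sum>x\<in>S. \<mu> x)"

definition marginal1 :: "'a set \<Rightarrow> ('a \<times> 'a \<Rightarrow> real) \<Rightarrow> 'a \<Rightarrow> real" where
  "marginal1 X \<pi> x = (\<Sum>x'\<in>X. \<pi> (x, x'))"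

definition marginal2 :: "'a set \<Rightarrow> ('a \<times> 'a \<Rightarrow> real) \<Rightarrow> 'a \<Rightarrow> real" where
  "marginal2 X \<pi> x' = (\<Sum>x\<in>X. \<pi> (x, x'))"

definition sub_couplings ::
    "'a set \<Rightarrow> ('a \<Rightarrow> real) \<Rightarrow> ('a \<Rightarrow> real) \<Rightarrow> ('a \<times> 'a \<Rightarrow> real) set" where
  "sub_couplings X \<mu> \<nu> =
    {\<pi> \<in> nonneg_measures (X \<times> X).
       (\<forall>x\<in>X. marginal1 X \<pi> x \<le> \<mu> x) \<and> (\<forall>x'\<in>X. marginal2 X \<pi> x' \<le> \<nu> x')}"

definition couplings ::
    "'a set \<Rightarrow> ('a \<Rightarrow> real) \<Rightarrow> ('a \<Rightarrow> real) \<Rightarrow> ('a \<times> 'a \<Rightarrow> real) set" where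
  "couplings X \<mu> \<nu> =
    {\<pi> \<in> nonneg_measures (X \<times> X).
       (\<forall>x\<in>X. marginal1 X \<pi> x = \<mu> x) \<and> (\<forall>x'\<in>X. marginal2 X \<pi> x' = \<nu> x')}"

definition transport_cost ::
    "'a set \<Rightarrow> ('a \<Rightarrow> 'a \<Rightarrow> real) \<Rightarrow> real \<Rightarrow> ('a \<times> 'a \<Rightarrow> real) \<Rightarrow> real" where
  "transport_cost X d p \<pi> = (\<Sum>x\<in>X. \<Sum>x'\<in>X. d x x' powr p * \<pi> (x, x'))"

text \<open>
  The minimum is taken over an infinite set of plans, so \<^const>\<open>Min\<close> does not apply. Here
  \<open>LEAST v. v \<in> S\<close> is the element of \<open>S\<close> that is a lower bound of \<open>S\<close>, i.e. an attained
  minimum; it is unspecified if there is none.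
\<close>

definition UOT ::
    "'a set \<Rightarrow> ('a \<Rightarrow> 'a \<Rightarrow> real) \<Rightarrow> real \<Rightarrow> real \<Rightarrow> ('a \<Rightarrow> real) \<Rightarrow> ('a \<Rightarrow> real) \<Rightarrow> real" where
  "UOT X d p C \<mu> \<nu> =
    (LEAST v. v \<in> (\<lambda>\<pi>. transport_cost X d p \<pi>
                        + C powr p * ((mass X \<mu> + mass X \<nu>) / 2 - mass (X \<times> X) \<pi>))
                  ` sub_couplings X \<mu> \<nu>)"

definition KR ::
    "'a set \<Rightarrow> ('a \<Rightarrow> 'a \<Rightarrow> real) \<Rightarrow> real \<Rightarrow> real \<Rightarrow> ('a \<Rightarrow> real) \<Rightarrow> ('a \<Rightarrow> real) \<Rightarrow> real" where
  "KR X d p C \<mu> \<nu> = UOT X d p C \<mu> \<nu> powr (1 / p)"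

text \<open>Only meaningful for measures of equal mass; otherwise there are no couplings.\<close>

definition Wasserstein ::
    "'a set \<Rightarrow> ('a \<Rightarrow> 'a \<Rightarrow> real) \<Rightarrow> real \<Rightarrow> ('a \<Rightarrow> real) \<Rightarrow> ('a \<Rightarrow> real) \<Rightarrow> real" where
  "Wasserstein X d p \<mu> \<nu> =
    (LEAST v. v \<in> transport_cost X d p ` couplings X \<mu> \<nu>) powr (1 / p)"

definition TV :: "'a set \<Rightarrow> ('a \<Rightarrow> real) \<Rightarrow> ('a \<Rightarrow> real) \<Rightarrow> real" where
  "TV X \<mu> \<nu> = (\<Sum>x\<in>X. \<bar>\<mu> x - \<nu> x\<bar>)"

end

theory Submission
  imports Defs
begin

text \<open>
  Unbalanced transport is balanced transport on a space with one extra point \<open>None\<close>, a reservoir at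
  distance \<open>C / 2 powr (1 / p)\<close> from every point of \<open>X\<close>: measures are topped up at \<open>None\<close> to a
  common total mass \<open>B\<close>, and \<open>d\<close> is capped at \<open>C\<close>. The augmented distance satisfies the triangle
  inequality because \<open>2 powr (1 / p) \<le> 2\<close>, so the triangle inequality for \<^const>\<open>KR\<close> follows by
  gluing couplings.

  For the total variation formulas, the plan that leaves the mass \<open>min (\<mu> x) (\<nu> x)\<close> in place gives
  the upper bound. Definiteness of \<^const>\<open>KR\<close> follows by comparing \<open>C\<close> with a constant below all
  nonzero distances. If \<open>C\<close> is at least the diameter and the masses agree, a sub-coupling can be completed
  to a coupling by the normalised product of the two residual measures at no extra cost.
\<close>

section \<open>Plans, their marginals and their mass\<close>

text \<open>Measures are extensional, so a plan given by a curried formula can belong to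
  \<open>nonneg_measures (X \<times> X)\<close> only after being set to \<open>undefined\<close> off
  the square.\<close>

definition plan :: "'a set \<Rightarrow> ('a \<Rightarrow> 'a \<Rightarrow> real) \<Rightarrow> 'a \<times> 'a \<Rightarrow> real" where
  "plan X f = restrict (\<lambda>(x, y). f x y) (X \<times> X)"

definition plan_cost ::
    "'a set \<Rightarrow> ('a \<Rightarrow> 'a \<Rightarrow> real) \<Rightarrow> real \<Rightarrow> real \<Rightarrow> ('a \<Rightarrow> real) \<Rightarrow> ('a \<Rightarrow> real)
      \<Rightarrow> ('a \<times> 'a \<Rightarrow> real) \<Rightarrow> real" where
  "plan_cost X d p C \<mu> \<nu> \<pi> =
     transport_cost X d p \<pi> + C powr p * ((mass X \<mu> + mass X \<nu>) / 2 - mass (X \<times> X) \<pi>)"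

lemma plan_apply [simp]: "x \<in> X \<Longrightarrow> y \<in> X \<Longrightarrow> plan X f (x, y) = f x y"
  by (simp add: plan_def)

lemma plan_in_nonneg_measures:
  "(\<And>x y. x \<in> X \<Longrightarrow> y \<in> X \<Longrightarrow> 0 \<le> f x y) \<Longrightarrow> plan X f \<in> nonneg_measures (X \<times> X)"
  by (auto simp: plan_def nonneg_measures_def)

lemma marginal1_plan: "x \<in> X \<Longrightarrow> marginal1 X (plan X f) x = (\<Sum>y\<in>X. f x y)"
  by (simp add: marginal1_def)

lemma marginal2_plan: "y \<in> X \<Longrightarrow> marginal2 X (plan X f) y = (\<Sum>x\<in>X. f x y)"
  by (simp add: marginal2_def)

lemma mass_times: "mass (X \<times> X) \<pi> = (\<Sum>x\<in>X. \<Sum>y\<in>X. \<pi> (x, y))"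
  by (simp add: mass_def sum.cartesian_product)

lemma mass_marginal1: "mass (X \<times> X) \<pi> = (\<Sum>x\<in>X. marginal1 X \<pi> x)"
  by (simp add: mass_times marginal1_def)

lemma mass_marginal2: "mass (X \<times> X) \<pi> = (\<Sum>y\<in>X. marginal2 X \<pi> y)"
  unfolding mass_times marginal2_def by (rule sum.swap)

lemma mass_plan: "mass (X \<times> X) (plan X f) = (\<Sum>x\<in>X. \<Sum>y\<in>X. f x y)"
  by (simp add: mass_times)

lemma transport_cost_plan:
  "transport_cost X d p (plan X f) = (\<Sum>x\<in>X. \<Sum>y\<in>X. d x y powr p * f x y)"
  by (simp add: transport_cost_def)

lemma nonneg_measuresD: "\<mu> \<in> nonneg_measures X \<Longrightarrow> x \<in> X \<Longrightarrow> 0 \<le> \<mu> x"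
  by (auto simp: nonneg_measures_def)

lemma sub_couplings_nonneg:
  "\<pi> \<in> sub_couplings X \<mu> \<nu> \<Longrightarrow> x \<in> X \<Longrightarrow> y \<in> X \<Longrightarrow> 0 \<le> \<pi> (x, y)"
  by (auto simp: sub_couplings_def dest: nonneg_measuresD)

lemma couplings_nonneg:
  "\<pi> \<in> couplings X \<mu> \<nu> \<Longrightarrow> x \<in> X \<Longrightarrow> y \<in> X \<Longrightarrow> 0 \<le> \<pi> (x, y)"
  by (auto simp: couplings_def dest: nonneg_measuresD)

lemma couplings_subset: "couplings X \<mu> \<nu> \<subseteq> sub_couplings X \<mu> \<nu>"
  by (auto simp: couplings_def sub_couplings_def)

lemma plan_in_sub_couplings:
  assumes "\<And>x y. x \<in> X \<Longrightarrow> y \<in> X \<Longrightarrow> 0 \<le> f x y"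
    and "\<And>x. x \<in> X \<Longrightarrow> (\<Sum>y\<in>X. f x y) \<le> \<mu> x"
    and "\<And>y. y \<in> X \<Longrightarrow> (\<Sum>x\<in>X. f x y) \<le> \<nu> y"
  shows "plan X f \<in> sub_couplings X \<mu> \<nu>"
  using assms by (simp add: sub_couplings_def plan_in_nonneg_measures marginal1_plan marginal2_plan)

lemma plan_in_couplings:
  assumes "\<And>x y. x \<in> X \<Longrightarrow> y \<in> X \<Longrightarrow> 0 \<le> f x y"
    and "\<And>x. x \<in> X \<Longrightarrow> (\<Sum>y\<in>X. f x y) = \<mu> x"
    and "\<And>y. y \<in> X \<Longrightarrow> (\<Sum>x\<in>X. f x y) = \<nu> y"
  shows "plan X f \<in> couplings X \<mu> \<nu>"
  using assms by (simp add: couplings_def plan_in_nonneg_measures marginal1_plan marginal2_plan)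

lemma mass_sub_coupling_le:
  assumes "\<pi> \<in> sub_couplings X \<mu> \<nu>"
  shows "mass (X \<times> X) \<pi> \<le> mass X \<mu>" "mass (X \<times> X) \<pi> \<le> mass X \<nu>"
proof -
  show "mass (X \<times> X) \<pi> \<le> mass X \<mu>"
    unfolding mass_marginal1 mass_def[of X]
    using assms by (intro sum_mono) (auto simp: sub_couplings_def)
  show "mass (X \<times> X) \<pi> \<le> mass X \<nu>"
    unfolding mass_marginal2 mass_def[of X]
    using assms by (intro sum_mono) (auto simp: sub_couplings_def)
qed

lemma sub_coupling_le:
  assumes "finite X" "\<pi> \<in> sub_couplings X \<mu> \<nu>" "x \<in> X" "y \<in> X"
  shows "\<pi> (x, y) \<le> \<mu> x" "\<pi> (x, y) \<le> \<nu> y"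
proof -
  have "\<pi> (x, y) \<le> marginal1 X \<pi> x" unfolding marginal1_def
    by (rule member_le_sum) (use assms sub_couplings_nonneg[OF assms(2)] in auto)
  then show "\<pi> (x, y) \<le> \<mu> x" using assms by (force simp: sub_couplings_def)
  have "\<pi> (x, y) \<le> marginal2 X \<pi> y" unfolding marginal2_def
    by (rule member_le_sum[where f = "\<lambda>x. \<pi> (x, y)"])
      (use assms sub_couplings_nonneg[OF assms(2)] in auto)
  then show "\<pi> (x, y) \<le> \<nu> y" using assms by (force simp: sub_couplings_def)
qed

section \<open>Compactness of the set of sub-couplings\<close>

text \<open>Tychonoff. The topology on functions is the product over the whole index type, so the
  coordinates outside \<open>I\<close> are treated as ranging over the compact singleton
  \<open>{undefined}\<close>.\<close>

lemma compact_PiE: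
  fixes K :: "'i \<Rightarrow> 'b::topological_space set"
  assumes "\<And>i. i \<in> I \<Longrightarrow> compact (K i)"
  shows "compact (PiE I K)"
proof -
  have "PiE I K = PiE UNIV (\<lambda>i. if i \<in> I then K i else {undefined})"
    by (force simp: PiE_def Pi_def extensional_def)
  moreover have "compactin (product_topology (\<lambda>i. euclidean) UNIV)
      (PiE UNIV (\<lambda>i. if i \<in> I then K i else {undefined}))"
    unfolding compactin_PiE using assms by auto
  ultimately show ?thesis by (simp add: euclidean_product_topology)
qed

text \<open>Nonnegative entries with row sums at most \<open>\<mu>\<close> are themselves at most
  \<open>\<mu> (fst z)\<close>. Adding these bounds changes nothing and exhibits the set as a
  compact box cut by closed conditions.\<close>

lemma compact_sub_couplings:
  fixes \<mu> \<nu> :: "'a \<Rightarrow> real"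
  assumes "finite X"
  shows "compact (sub_couplings X \<mu> \<nu>)"
proof -
  have eq: "sub_couplings X \<mu> \<nu> =
      PiE (X \<times> X) (\<lambda>z. {0..\<mu> (fst z)}) \<inter>
      ((\<Inter>x\<in>X. {\<pi>. marginal1 X \<pi> x \<le> \<mu> x}) \<inter> (\<Inter>y\<in>X. {\<pi>. marginal2 X \<pi> y \<le> \<nu> y}))"
    (is "?L = ?R")
  proof
    show "?L \<subseteq> ?R"
    proof
      fix \<pi> assume \<pi>: "\<pi> \<in> ?L"
      show "\<pi> \<in> ?R"
        using \<pi> sub_coupling_le(1)[OF assms \<pi>]
        by (simp add: sub_couplings_def nonneg_measures_def PiE_iff)
    qed
    show "?R \<subseteq> ?L"
      by (auto simp: sub_couplings_def nonneg_measures_def PiE_iff)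
  qed
  have "closed {\<pi> :: 'a \<times> 'a \<Rightarrow> real. marginal1 X \<pi> x \<le> \<mu> x}" for x
    unfolding marginal1_def
    by (intro closed_Collect_le continuous_intros continuous_on_product_coordinates)
  moreover have "closed {\<pi> :: 'a \<times> 'a \<Rightarrow> real. marginal2 X \<pi> y \<le> \<nu> y}" for y
    unfolding marginal2_def
    by (intro closed_Collect_le continuous_intros continuous_on_product_coordinates)
  ultimately show ?thesis
    unfolding eq by (intro compact_Int_closed compact_PiE closed_Int closed_INT) auto
qed

section \<open>A weighted power inequality and the gluing of couplings\<close>

text \<open>For positive arguments this is convexity of the power function. If one argument is 0, it
  reduces to \<open>w powr p \<le> w\<close> for a weight \<open>w\<close> in (0,1], which uses
  \<open>p \<ge> 1\<close>.\<close>

lemma powr_convex_nonneg: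
  fixes p x y u v :: real
  assumes "p \<ge> 1" "0 \<le> x" "0 \<le> y" "0 < u" "0 < v" "u + v = 1"
  shows "(u * x + v * y) powr p \<le> u * x powr p + v * y powr p"
proof -
  have small: "w powr p \<le> w" if "0 < w" "w \<le> 1" for w :: real
    using powr_mono'[of 1 p w] that assms(1) by simp
  consider "x = 0" | "y = 0" | "0 < x" "0 < y" using assms by linarith
  then show ?thesis
  proof cases
    case 1
    then show ?thesis using assms small[of v] by (simp add: powr_mult mult_right_mono)
  next
    case 2
    then show ?thesis using assms small[of u] by (simp add: powr_mult mult_right_mono)
  next
    case 3
    then show ?thesis using powr_convex[OF assms(1)] assms unfolding convex_on_def by simp
  qed
qed

text \<open>\<open>(a + b) / (A + B)\<close> is the convex combination of \<open>a / A\<close> and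
  \<open>b / B\<close> with weights proportional to \<open>A\<close> and \<open>B\<close>. The
  weights are such that replacing \<open>a powr p\<close> and \<open>b powr p\<close> by
  \<open>A powr p\<close> and \<open>B powr p\<close> turns the right-hand side into
  \<open>(A + B) powr p\<close>.\<close>

lemma powr_add_le_weighted:
  fixes p a b A B :: real
  assumes "p \<ge> 1" "0 \<le> a" "0 \<le> b" "0 < A" "0 < B"
  shows "(a + b) powr p \<le> (A + B) powr p *
           (A / (A + B) * (a powr p / A powr p) + B / (A + B) * (b powr p / B powr p))"
proof -
  have "A / (A + B) * (a / A) + B / (A + B) * (b / B) = (a + b) / (A + B)"
    using assms by (simp add: add_divide_distrib)
  then have "a + b = (A + B) * (A / (A + B) * (a / A) + B / (A + B) * (b / B))"
    using assms by simp
  then have "(a + b) powr p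
      = (A + B) powr p * (A / (A + B) * (a / A) + B / (A + B) * (b / B)) powr p"
    using assms by (metis add_nonneg_nonneg divide_nonneg_nonneg less_imp_le mult_nonneg_nonneg powr_mult)
  also have "\<dots> \<le> (A + B) powr p *
      (A / (A + B) * (a / A) powr p + B / (A + B) * (b / B) powr p)"
    using assms by (intro mult_left_mono powr_convex_nonneg) (auto simp: add_divide_distrib[symmetric])
  finally show ?thesis using assms by (simp add: powr_divide)
qed

text \<open>
  The plan is the projection of the gluing \<open>\<pi>\<^sub>1(x,y) \<pi>\<^sub>2(y,z) / b(y)\<close>; where \<open>b y = 0\<close> the junk
  value of the division is the right one, since then \<open>\<pi>\<^sub>1(\<cdot>,y)\<close> and \<open>\<pi>\<^sub>2(y,\<cdot>)\<close> vanish. The bound is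
  Minkowski's inequality, in a form that needs only the convexity of \<open>t powr p\<close>.
\<close>

lemma glued_coupling:
  fixes e :: "'b \<Rightarrow> 'b \<Rightarrow> real" and A B p :: real
  assumes fin: "finite Y" and p: "p \<ge> 1"
    and nonneg: "\<And>x y. x \<in> Y \<Longrightarrow> y \<in> Y \<Longrightarrow> 0 \<le> e x y"
    and triangle: "\<And>x y z. x \<in> Y \<Longrightarrow> y \<in> Y \<Longrightarrow> z \<in> Y \<Longrightarrow> e x z \<le> e x y + e y z"
    and \<pi>1: "\<pi>1 \<in> couplings Y a b" and \<pi>2: "\<pi>2 \<in> couplings Y b c"
    and AB: "0 < A" "0 < B"
    and cost1: "transport_cost Y e p \<pi>1 \<le> A powr p"
    and cost2: "transport_cost Y e p \<pi>2 \<le> B powr p"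
  obtains \<pi> where "\<pi> \<in> couplings Y a c" "transport_cost Y e p \<pi> \<le> (A + B) powr p"
proof
  define \<sigma> where "\<sigma> x y z = \<pi>1 (x, y) * \<pi>2 (y, z) / b y" for x y z
  note nn1 = couplings_nonneg[OF \<pi>1] and nn2 = couplings_nonneg[OF \<pi>2]
  have m1: "(\<Sum>y\<in>Y. \<pi>1 (x, y)) = a x" "(\<Sum>y\<in>Y. \<pi>1 (y, x)) = b x"
    and m2: "(\<Sum>y\<in>Y. \<pi>2 (x, y)) = b x" "(\<Sum>y\<in>Y. \<pi>2 (y, x)) = c x" if "x \<in> Y" for x
    using \<pi>1 \<pi>2 that by (auto simp: couplings_def marginal1_def marginal2_def)
  have b_nonneg: "0 \<le> b y" if "y \<in> Y" for y
    using m2(1)[OF that] nn2[OF that] by (metis sum_nonneg)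
  have z1: "\<pi>1 (x, y) = 0" if "x \<in> Y" "y \<in> Y" "b y = 0" for x y
    using m1(2)[OF that(2)] that nn1[OF _ that(2)] by (simp add: sum_nonneg_eq_0_iff[OF fin])
  have z2: "\<pi>2 (y, z) = 0" if "y \<in> Y" "z \<in> Y" "b y = 0" for y z
    using m2(1)[OF that(1)] that nn2[OF that(1)] by (simp add: sum_nonneg_eq_0_iff[OF fin])
  have \<sigma>_nonneg: "0 \<le> \<sigma> x y z" if "x \<in> Y" "y \<in> Y" "z \<in> Y" for x y z
    using that nn1 nn2 b_nonneg by (simp add: \<sigma>_def)
  have \<sigma>1: "(\<Sum>z\<in>Y. \<sigma> x y z) = \<pi>1 (x, y)" if "x \<in> Y" "y \<in> Y" for x y
    using that z1 m2(1)[OF that(2)]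
    by (cases "b y = 0") (simp_all add: \<sigma>_def sum_divide_distrib[symmetric] sum_distrib_left[symmetric])
  have \<sigma>2: "(\<Sum>x\<in>Y. \<sigma> x y z) = \<pi>2 (y, z)" if "y \<in> Y" "z \<in> Y" for y z
    using that z2 m1(2)[OF that(1)]
    by (cases "b y = 0") (simp_all add: \<sigma>_def sum_divide_distrib[symmetric] sum_distrib_right[symmetric])
  show "plan Y (\<lambda>x z. \<Sum>y\<in>Y. \<sigma> x y z) \<in> couplings Y a c"
  proof (rule plan_in_couplings)
    show "0 \<le> (\<Sum>y\<in>Y. \<sigma> x y z)" if "x \<in> Y" "z \<in> Y" for x z
      using that \<sigma>_nonneg by (intro sum_nonneg) auto
    show "(\<Sum>z\<in>Y. \<Sum>y\<in>Y. \<sigma> x y z) = a x" if "x \<in> Y" for x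
      by (subst sum.swap) (simp add: that \<sigma>1 m1)
    show "(\<Sum>x\<in>Y. \<Sum>y\<in>Y. \<sigma> x y z) = c z" if "z \<in> Y" for z
      by (subst sum.swap) (simp add: that \<sigma>2 m2)
  qed
  \<comment> \<open>Coefficients of the weighted inequality;
    \<open>K1 * A powr p + K2 * B powr p\<close> is exactly \<open>(A + B) powr p\<close>.\<close>
  define K1 where "K1 = (A + B) powr p * (A / (A + B)) / A powr p"
  define K2 where "K2 = (A + B) powr p * (B / (A + B)) / B powr p"
  have K: "e x z powr p \<le> K1 * e x y powr p + K2 * e y z powr p"
    if "x \<in> Y" "y \<in> Y" "z \<in> Y" for x y z
  proof -
    have "e x z powr p \<le> (e x y + e y z) powr p"
      using that nonneg triangle p by (intro powr_mono2) auto
    also have "\<dots> \<le> K1 * e x y powr p + K2 * e y z powr p"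
      using powr_add_le_weighted[OF p nonneg[OF that(1,2)] nonneg[OF that(2,3)] AB]
      by (simp add: K1_def K2_def distrib_left mult_ac)
    finally show ?thesis .
  qed
  have "transport_cost Y e p (plan Y (\<lambda>x z. \<Sum>y\<in>Y. \<sigma> x y z))
      = (\<Sum>x\<in>Y. \<Sum>z\<in>Y. \<Sum>y\<in>Y. e x z powr p * \<sigma> x y z)"
    by (simp add: transport_cost_plan sum_distrib_left)
  also have "\<dots> \<le> (\<Sum>x\<in>Y. \<Sum>z\<in>Y. \<Sum>y\<in>Y. (K1 * e x y powr p + K2 * e y z powr p) * \<sigma> x y z)"
    using K \<sigma>_nonneg by (intro sum_mono mult_right_mono) auto
  \<comment> \<open>Each of the two terms involves the distance along one leg only. After reordering
    the sums, the remaining variable is summed out and \<open>\<sigma>\<close> collapses to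
    \<open>\<pi>1\<close> or \<open>\<pi>2\<close>.\<close>
  also have "\<dots> = (\<Sum>x\<in>Y. \<Sum>z\<in>Y. \<Sum>y\<in>Y. K1 * (e x y powr p * \<sigma> x y z))
      + (\<Sum>x\<in>Y. \<Sum>z\<in>Y. \<Sum>y\<in>Y. K2 * (e y z powr p * \<sigma> x y z))"
    unfolding sum.distrib[symmetric] by (intro sum.cong refl) (simp add: algebra_simps)
  also have "(\<Sum>x\<in>Y. \<Sum>z\<in>Y. \<Sum>y\<in>Y. K1 * (e x y powr p * \<sigma> x y z))
      = (\<Sum>x\<in>Y. \<Sum>y\<in>Y. \<Sum>z\<in>Y. K1 * (e x y powr p * \<sigma> x y z))"
    by (intro sum.cong refl sum.swap)
  also have "\<dots> = K1 * transport_cost Y e p \<pi>1"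
    by (simp add: transport_cost_def sum_distrib_left[symmetric] \<sigma>1)
  also have "(\<Sum>x\<in>Y. \<Sum>z\<in>Y. \<Sum>y\<in>Y. K2 * (e y z powr p * \<sigma> x y z))
      = (\<Sum>z\<in>Y. \<Sum>x\<in>Y. \<Sum>y\<in>Y. K2 * (e y z powr p * \<sigma> x y z))"
    by (rule sum.swap)
  also have "\<dots> = (\<Sum>z\<in>Y. \<Sum>y\<in>Y. \<Sum>x\<in>Y. K2 * (e y z powr p * \<sigma> x y z))"
    by (intro sum.cong refl sum.swap)
  also have "\<dots> = (\<Sum>y\<in>Y. \<Sum>z\<in>Y. \<Sum>x\<in>Y. K2 * (e y z powr p * \<sigma> x y z))"
    by (rule sum.swap)
  also have "\<dots> = K2 * transport_cost Y e p \<pi>2"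
    by (simp add: transport_cost_def sum_distrib_left[symmetric] \<sigma>2)
  also have "K1 * transport_cost Y e p \<pi>1 + K2 * transport_cost Y e p \<pi>2
      \<le> K1 * A powr p + K2 * B powr p"
    using cost1 cost2 AB by (intro add_mono mult_left_mono) (auto simp: K1_def K2_def)
  also have "\<dots> = (A + B) powr p * (A / (A + B) + B / (A + B))"
    using AB by (simp add: K1_def K2_def distrib_left)
  also have "\<dots> = (A + B) powr p"
    using AB by (simp add: add_divide_distrib[symmetric])
  finally show "transport_cost Y e p (plan Y (\<lambda>x z. \<Sum>y\<in>Y. \<sigma> x y z)) \<le> (A + B) powr p" .
qed

section \<open>Optimal plans, nonnegativity and symmetry\<close>

locale finite_transport = Metric_space X d
  for X :: "'a set" and d :: "'a \<Rightarrow> 'a \<Rightarrow> real" +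
  fixes p :: real
  assumes finite_X: "finite X" and p_ge_1: "p \<ge> 1"
begin

lemma transport_cost_nonneg:
  "\<pi> \<in> sub_couplings X \<mu> \<nu> \<Longrightarrow> 0 \<le> transport_cost X d p \<pi>"
  unfolding transport_cost_def
  by (intro sum_nonneg mult_nonneg_nonneg sub_couplings_nonneg[of \<pi> X \<mu> \<nu>]) auto

lemma plan_cost_nonneg:
  assumes "\<pi> \<in> sub_couplings X \<mu> \<nu>"
  shows "0 \<le> plan_cost X d p C \<mu> \<nu> \<pi>"
  using transport_cost_nonneg[OF assms] mass_sub_coupling_le[OF assms]
  by (simp add: plan_cost_def)

text \<open>A continuous function attains its infimum on a nonempty compact set; the zero plan shows
  nonemptiness. This gives the \<open>LEAST\<close> in \<open>UOT\<close> its intended meaning of an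
  attained minimum.\<close>

lemma optimal_plan:
  assumes \<mu>: "\<mu> \<in> nonneg_measures X" and \<nu>: "\<nu> \<in> nonneg_measures X"
  obtains \<pi> where "\<pi> \<in> sub_couplings X \<mu> \<nu>" "UOT X d p C \<mu> \<nu> = plan_cost X d p C \<mu> \<nu> \<pi>"
    "\<And>\<pi>'. \<pi>' \<in> sub_couplings X \<mu> \<nu> \<Longrightarrow> UOT X d p C \<mu> \<nu> \<le> plan_cost X d p C \<mu> \<nu> \<pi>'"
proof -
  have "plan X (\<lambda>x y. 0) \<in> sub_couplings X \<mu> \<nu>"
    using nonneg_measuresD[OF \<mu>] nonneg_measuresD[OF \<nu>] by (intro plan_in_sub_couplings) auto
  then have "sub_couplings X \<mu> \<nu> \<noteq> {}" by blast
  moreover have "continuous_on (sub_couplings X \<mu> \<nu>) (plan_cost X d p C \<mu> \<nu>)"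
    unfolding plan_cost_def transport_cost_def mass_def
    by (intro continuous_intros continuous_on_subset[OF continuous_on_product_coordinates]) auto
  ultimately obtain \<pi> where \<pi>: "\<pi> \<in> sub_couplings X \<mu> \<nu>"
      "\<And>\<pi>'. \<pi>' \<in> sub_couplings X \<mu> \<nu> \<Longrightarrow> plan_cost X d p C \<mu> \<nu> \<pi> \<le> plan_cost X d p C \<mu> \<nu> \<pi>'"
    using continuous_attains_inf[OF compact_sub_couplings[OF finite_X]] by metis
  then have "UOT X d p C \<mu> \<nu> = plan_cost X d p C \<mu> \<nu> \<pi>"
    unfolding UOT_def plan_cost_def[symmetric] by (intro Least_equality) auto
  with \<pi> show thesis by (intro that) auto
qed

lemma UOT_nonneg:
  assumes "\<mu> \<in> nonneg_measures X" "\<nu> \<in> nonneg_measures X"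
  shows "0 \<le> UOT X d p C \<mu> \<nu>"
proof -
  obtain \<pi> where "\<pi> \<in> sub_couplings X \<mu> \<nu>" "UOT X d p C \<mu> \<nu> = plan_cost X d p C \<mu> \<nu> \<pi>"
    using optimal_plan[OF assms] by blast
  then show ?thesis using plan_cost_nonneg by simp
qed

lemma UOT_le:
  assumes "\<mu> \<in> nonneg_measures X" "\<nu> \<in> nonneg_measures X" "\<pi> \<in> sub_couplings X \<mu> \<nu>"
  shows "UOT X d p C \<mu> \<nu> \<le> plan_cost X d p C \<mu> \<nu> \<pi>"
  by (rule optimal_plan[OF assms(1,2), where C = C]) (use assms(3) in blast)

lemma KR_powr:
  assumes "\<mu> \<in> nonneg_measures X" "\<nu> \<in> nonneg_measures X"
  shows "KR X d p C \<mu> \<nu> powr p = UOT X d p C \<mu> \<nu>"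
  using UOT_nonneg[OF assms] p_ge_1 by (simp add: KR_def powr_powr)

lemma swapped_plan:
  assumes "\<pi> \<in> sub_couplings X \<mu> \<nu>"
  shows "plan X (\<lambda>x y. \<pi> (y, x)) \<in> sub_couplings X \<nu> \<mu>"
    and "plan_cost X d p C \<nu> \<mu> (plan X (\<lambda>x y. \<pi> (y, x))) = plan_cost X d p C \<mu> \<nu> \<pi>"
proof -
  show "plan X (\<lambda>x y. \<pi> (y, x)) \<in> sub_couplings X \<nu> \<mu>"
    using assms sub_couplings_nonneg[OF assms]
    by (intro plan_in_sub_couplings) (auto simp: sub_couplings_def marginal1_def marginal2_def)
  have "transport_cost X d p (plan X (\<lambda>x y. \<pi> (y, x))) = transport_cost X d p \<pi>"
    unfolding transport_cost_plan unfolding transport_cost_def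
    by (subst sum.swap) (simp add: commute)
  moreover have "mass (X \<times> X) (plan X (\<lambda>x y. \<pi> (y, x))) = mass (X \<times> X) \<pi>"
    unfolding mass_plan unfolding mass_times by (rule sum.swap)
  ultimately show "plan_cost X d p C \<nu> \<mu> (plan X (\<lambda>x y. \<pi> (y, x))) = plan_cost X d p C \<mu> \<nu> \<pi>"
    by (simp add: plan_cost_def add.commute)
qed

text \<open>\<open>Metric_space\<close> demands symmetry for all arguments, including functions
  outside \<open>nonneg_measures X\<close>. Hence transposition is used to identify the two sets of
  attainable costs, which equates the \<open>LEAST\<close> values in every case.\<close>

lemma UOT_commute: "UOT X d p C \<mu> \<nu> = UOT X d p C \<nu> \<mu>"
proof -
  have sub: "plan_cost X d p C \<mu> \<nu> ` sub_couplings X \<mu> \<nu>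
      \<subseteq> plan_cost X d p C \<nu> \<mu> ` sub_couplings X \<nu> \<mu>" for \<mu> \<nu>
  proof
    fix v assume "v \<in> plan_cost X d p C \<mu> \<nu> ` sub_couplings X \<mu> \<nu>"
    then obtain \<pi> where "\<pi> \<in> sub_couplings X \<mu> \<nu>" "v = plan_cost X d p C \<mu> \<nu> \<pi>" by blast
    then show "v \<in> plan_cost X d p C \<nu> \<mu> ` sub_couplings X \<nu> \<mu>"
      using swapped_plan by (auto intro!: image_eqI[where x = "plan X (\<lambda>x y. \<pi> (y, x))"])
  qed
  have "plan_cost X d p C \<mu> \<nu> ` sub_couplings X \<mu> \<nu>
      = plan_cost X d p C \<nu> \<mu> ` sub_couplings X \<nu> \<mu>"
    by (rule equalityI[OF sub sub])
  then show ?thesis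
    unfolding UOT_def plan_cost_def[symmetric] by simp
qed

section \<open>Total variation and dependence on \<open>C\<close>\<close>

text \<open>Pointwise, \<open>\<bar>a - b\<bar> = a + b - 2 * min a b\<close>. The right-hand side
  is the factor of \<open>C powr p\<close> in the cost of the plan that keeps the common mass in
  place.\<close>

lemma half_TV: "TV X \<mu> \<nu> / 2 = (mass X \<mu> + mass X \<nu>) / 2 - (\<Sum>x\<in>X. min (\<mu> x) (\<nu> x))"
proof -
  have "(\<Sum>x\<in>X. \<bar>\<mu> x - \<nu> x\<bar>) = (\<Sum>x\<in>X. \<mu> x + \<nu> x - 2 * min (\<mu> x) (\<nu> x))"
    by (intro sum.cong) auto
  then show ?thesis
    by (simp add: TV_def mass_def sum.distrib sum_subtractf sum_distrib_left[symmetric])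
qed

lemma UOT_le_TV:
  assumes "\<mu> \<in> nonneg_measures X" "\<nu> \<in> nonneg_measures X"
  shows "UOT X d p C \<mu> \<nu> \<le> C powr p / 2 * TV X \<mu> \<nu>"
proof -
  let ?f = "\<lambda>x y. if x = y then min (\<mu> x) (\<nu> x) else 0"
  have "plan X ?f \<in> sub_couplings X \<mu> \<nu>"
    using assms by (intro plan_in_sub_couplings)
      (auto simp: sum.delta[OF finite_X] sum.delta'[OF finite_X] nonneg_measuresD)
  moreover have "transport_cost X d p (plan X ?f) = 0"
    unfolding transport_cost_plan by (intro sum.neutral ballI) auto
  moreover have "mass (X \<times> X) (plan X ?f) = (\<Sum>x\<in>X. min (\<mu> x) (\<nu> x))"
    by (simp add: mass_plan sum.delta'[OF finite_X])
  ultimately have "UOT X d p C \<mu> \<nu> \<le> C powr p * (TV X \<mu> \<nu> / 2)"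
    unfolding half_TV using UOT_le[OF assms, of "plan X ?f" C] by (simp add: plan_cost_def)
  then show ?thesis by simp
qed

text \<open>An off-diagonal unit costs at least \<open>C powr p\<close> to move, which is all that
  matching it saves in the penalty. So only diagonal mass can lower the cost, and at
  \<open>x\<close> there is at most \<open>min (\<mu> x) (\<nu> x)\<close> of it.\<close>

lemma UOT_ge_TV_small:
  assumes \<mu>: "\<mu> \<in> nonneg_measures X" and \<nu>: "\<nu> \<in> nonneg_measures X"
    and C: "0 < C" "\<And>x y. x \<in> X \<Longrightarrow> y \<in> X \<Longrightarrow> x \<noteq> y \<Longrightarrow> C \<le> d x y"
  shows "C powr p / 2 * TV X \<mu> \<nu> \<le> UOT X d p C \<mu> \<nu>"
proof -
  obtain \<pi> where \<pi>: "\<pi> \<in> sub_couplings X \<mu> \<nu>" "UOT X d p C \<mu> \<nu> = plan_cost X d p C \<mu> \<nu> \<pi>"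
    using optimal_plan[OF \<mu> \<nu>] by blast
  note nn = sub_couplings_nonneg[OF \<pi>(1)]
  have "C powr p * mass (X \<times> X) \<pi> - C powr p * (\<Sum>x\<in>X. \<pi> (x, x))
      = (\<Sum>x\<in>X. \<Sum>y\<in>X. C powr p * (\<pi> (x, y) - (if x = y then \<pi> (x, x) else 0)))"
    by (simp add: mass_times sum_distrib_left[symmetric] sum_subtractf sum.delta'[OF finite_X]
        right_diff_distrib)
  also have "\<dots> \<le> transport_cost X d p \<pi>"
    unfolding transport_cost_def
    using C nn p_ge_1 by (intro sum_mono) (auto intro!: mult_right_mono powr_mono2)
  finally have "C powr p * mass (X \<times> X) \<pi> - C powr p * (\<Sum>x\<in>X. \<pi> (x, x))
      \<le> transport_cost X d p \<pi>" .
  moreover have "C powr p * (\<Sum>x\<in>X. \<pi> (x, x)) \<le> C powr p * (\<Sum>x\<in>X. min (\<mu> x) (\<nu> x))"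
    using sub_coupling_le[OF finite_X \<pi>(1)] by (intro mult_left_mono sum_mono) auto
  ultimately show ?thesis
    using arg_cong[OF half_TV[of \<mu> \<nu>], of "(*) (C powr p)"]
    unfolding \<pi>(2) plan_cost_def by (simp add: right_diff_distrib)
qed

text \<open>No plan carries more than the smaller of the two masses. For ordered measures this is
  the mass of the pointwise minimum, so the penalty alone already reaches the bound.\<close>

lemma UOT_ge_TV_ordered:
  assumes \<mu>: "\<mu> \<in> nonneg_measures X" and \<nu>: "\<nu> \<in> nonneg_measures X"
    and ord: "(\<forall>x\<in>X. \<nu> x \<le> \<mu> x) \<or> (\<forall>x\<in>X. \<mu> x \<le> \<nu> x)"
  shows "C powr p / 2 * TV X \<mu> \<nu> \<le> UOT X d p C \<mu> \<nu>"
proof -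
  obtain \<pi> where \<pi>: "\<pi> \<in> sub_couplings X \<mu> \<nu>" "UOT X d p C \<mu> \<nu> = plan_cost X d p C \<mu> \<nu> \<pi>"
    using optimal_plan[OF \<mu> \<nu>] by blast
  have "(\<Sum>x\<in>X. min (\<mu> x) (\<nu> x)) = mass X \<mu> \<or> (\<Sum>x\<in>X. min (\<mu> x) (\<nu> x)) = mass X \<nu>"
    using ord unfolding mass_def by (auto intro!: sum.cong)
  then have "mass (X \<times> X) \<pi> \<le> (\<Sum>x\<in>X. min (\<mu> x) (\<nu> x))"
    using mass_sub_coupling_le[OF \<pi>(1)] by auto
  then have "C powr p * (TV X \<mu> \<nu> / 2)
      \<le> C powr p * ((mass X \<mu> + mass X \<nu>) / 2 - mass (X \<times> X) \<pi>)"
    unfolding half_TV by (intro mult_left_mono) auto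
  then show ?thesis
    using transport_cost_nonneg[OF \<pi>(1)] unfolding \<pi>(2) plan_cost_def by simp
qed

text \<open>A plan optimal for \<open>C2\<close> competes for \<open>C1\<close>, and its penalty
  factor is nonnegative because the carried mass is at most either total mass.\<close>

lemma UOT_mono:
  assumes \<mu>: "\<mu> \<in> nonneg_measures X" and \<nu>: "\<nu> \<in> nonneg_measures X"
    and C: "0 < C1" "C1 \<le> C2"
  shows "UOT X d p C1 \<mu> \<nu> \<le> UOT X d p C2 \<mu> \<nu>"
proof -
  obtain \<pi> where \<pi>: "\<pi> \<in> sub_couplings X \<mu> \<nu>" "UOT X d p C2 \<mu> \<nu> = plan_cost X d p C2 \<mu> \<nu> \<pi>"
    using optimal_plan[OF \<mu> \<nu>] by blast
  have "UOT X d p C1 \<mu> \<nu> \<le> plan_cost X d p C1 \<mu> \<nu> \<pi>"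
    by (rule UOT_le[OF \<mu> \<nu> \<pi>(1)])
  also have "\<dots> \<le> plan_cost X d p C2 \<mu> \<nu> \<pi>"
    unfolding plan_cost_def using C p_ge_1 mass_sub_coupling_le[OF \<pi>(1)]
    by (intro add_left_mono mult_right_mono powr_mono2) auto
  finally show ?thesis using \<pi>(2) by simp
qed

section \<open>Comparison with the Wasserstein distance\<close>

lemma completed_coupling:
  assumes \<pi>: "\<pi> \<in> sub_couplings X \<mu> \<nu>" and mass: "mass X \<mu> = mass X \<nu>"
    and C: "\<And>x y. x \<in> X \<Longrightarrow> y \<in> X \<Longrightarrow> d x y \<le> C"
  obtains \<pi>' where "\<pi>' \<in> couplings X \<mu> \<nu>"
    "transport_cost X d p \<pi>' \<le> plan_cost X d p C \<mu> \<nu> \<pi>"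
proof
  define a where "a x = \<mu> x - marginal1 X \<pi> x" for x
  define b where "b y = \<nu> y - marginal2 X \<pi> y" for y
  define m where "m = mass X \<mu> - mass (X \<times> X) \<pi>"
  have a: "0 \<le> a x" "0 \<le> b x" if "x \<in> X" for x
    using \<pi> that by (auto simp: a_def b_def sub_couplings_def)
  have sum_a: "(\<Sum>x\<in>X. a x) = m"
    by (simp add: a_def m_def mass_def[of X] mass_marginal1 sum_subtractf)
  have sum_b: "(\<Sum>x\<in>X. b x) = m"
    unfolding m_def mass by (simp add: b_def mass_def[of X] mass_marginal2 sum_subtractf)
  have m: "0 \<le> m" using mass_sub_coupling_le[OF \<pi>] by (simp add: m_def)
  have zero: "a x = 0" "b x = 0" if "x \<in> X" "m = 0" for x
    using that a sum_a sum_b sum_nonneg_eq_0_iff[OF finite_X, of a]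
      sum_nonneg_eq_0_iff[OF finite_X, of b] by auto
  \<comment> \<open>\<open>m\<close> is the common residual mass and normalises the product
    \<open>a x * b y\<close>. If \<open>m = 0\<close>, both residuals vanish, so the value 0 of
    division by zero is the right one.\<close>
  have am: "a x * m / m = a x" "b x * m / m = b x" if "x \<in> X" for x
    using zero[OF that] by auto
  let ?f = "\<lambda>x y. \<pi> (x, y) + a x * b y / m"
  show "plan X ?f \<in> couplings X \<mu> \<nu>"
  proof (rule plan_in_couplings)
    show "0 \<le> ?f x y" if "x \<in> X" "y \<in> X" for x y
      using that a m sub_couplings_nonneg[OF \<pi>] by simp
    show "(\<Sum>y\<in>X. ?f x y) = \<mu> x" if "x \<in> X" for x
      using am(1)[OF that]
      by (simp add: sum.distrib sum_divide_distrib[symmetric] sum_distrib_left[symmetric] sum_b)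
        (simp add: a_def marginal1_def)
    show "(\<Sum>x\<in>X. ?f x y) = \<nu> y" if "y \<in> X" for y
      using am(2)[OF that]
      by (simp add: sum.distrib sum_divide_distrib[symmetric] sum_distrib_right[symmetric] sum_a
          mult.commute) (simp add: b_def marginal2_def)
  qed
  have "transport_cost X d p (plan X ?f)
      = transport_cost X d p \<pi> + (\<Sum>x\<in>X. \<Sum>y\<in>X. d x y powr p * (a x * b y / m))"
    unfolding transport_cost_plan
    by (simp add: transport_cost_def sum.distrib distrib_left)
  also have "(\<Sum>x\<in>X. \<Sum>y\<in>X. d x y powr p * (a x * b y / m))
      \<le> (\<Sum>x\<in>X. \<Sum>y\<in>X. C powr p * (a x * b y / m))"
    using C a m p_ge_1 by (intro sum_mono mult_right_mono powr_mono2) auto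
  also have "\<dots> = C powr p / m * ((\<Sum>x\<in>X. a x) * (\<Sum>y\<in>X. b y))"
    by (simp only: sum_product) (simp add: sum_distrib_left)
  \<comment> \<open>Equal masses make the averaged mass minus the carried mass equal to
    \<open>m\<close>: moving the residual costs at most the penalty that it avoids.\<close>
  also have "\<dots> = C powr p * ((mass X \<mu> + mass X \<nu>) / 2 - mass (X \<times> X) \<pi>)"
    using mass unfolding sum_a sum_b by (simp add: m_def)
  finally show "transport_cost X d p (plan X ?f) \<le> plan_cost X d p C \<mu> \<nu> \<pi>"
    by (simp add: plan_cost_def)
qed

text \<open>Couplings are sub-couplings whose penalty vanishes, so \<open>UOT\<close> bounds their
  costs from below. Completing an optimal sub-coupling gives a coupling that attains this bound;
  hence the minimum in \<open>Wasserstein\<close> exists and has the same value.\<close>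

lemma UOT_eq_Wasserstein:
  assumes \<mu>: "\<mu> \<in> nonneg_measures X" and \<nu>: "\<nu> \<in> nonneg_measures X"
    and mass: "mass X \<mu> = mass X \<nu>"
    and C: "\<And>x y. x \<in> X \<Longrightarrow> y \<in> X \<Longrightarrow> d x y \<le> C"
  shows "UOT X d p C \<mu> \<nu> = Wasserstein X d p \<mu> \<nu> powr p"
proof -
  have lower: "UOT X d p C \<mu> \<nu> \<le> transport_cost X d p \<pi>" if "\<pi> \<in> couplings X \<mu> \<nu>" for \<pi>
  proof -
    have "mass (X \<times> X) \<pi> = mass X \<mu>"
      using that by (auto simp: mass_marginal1 mass_def[of X] couplings_def)
    then show ?thesis
      using UOT_le[OF \<mu> \<nu> subsetD[OF couplings_subset that], of C] mass
      by (simp add: plan_cost_def)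
  qed
  obtain \<pi> where \<pi>: "\<pi> \<in> sub_couplings X \<mu> \<nu>" "UOT X d p C \<mu> \<nu> = plan_cost X d p C \<mu> \<nu> \<pi>"
    using optimal_plan[OF \<mu> \<nu>] by blast
  obtain \<pi>' where \<pi>': "\<pi>' \<in> couplings X \<mu> \<nu>" "transport_cost X d p \<pi>' \<le> UOT X d p C \<mu> \<nu>"
    unfolding \<pi>(2) using completed_coupling[OF \<pi>(1) mass C] by blast
  have "(LEAST v. v \<in> transport_cost X d p ` couplings X \<mu> \<nu>) = UOT X d p C \<mu> \<nu>"
    using lower \<pi>' by (intro Least_equality) (auto intro!: image_eqI[of _ _ \<pi>'] antisym)
  then show ?thesis
    using UOT_nonneg[OF \<mu> \<nu>, of C] p_ge_1 by (simp add: Wasserstein_def powr_powr)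
qed

section \<open>The space augmented by a reservoir\<close>

definition aug_space :: "'a option set" where
  "aug_space = insert None (Some ` X)"

text \<open>The distance to the reservoir is chosen so that its power is
  \<open>C powr p / 2\<close>, the amount that the penalty charges for every unmatched unit of
  \<open>\<mu>\<close> or of \<open>\<nu>\<close>.\<close>

fun aug_dist :: "real \<Rightarrow> 'a option \<Rightarrow> 'a option \<Rightarrow> real" where
  "aug_dist C None None = 0"
| "aug_dist C None (Some y) = C / 2 powr (1 / p)"
| "aug_dist C (Some x) None = C / 2 powr (1 / p)"
| "aug_dist C (Some x) (Some y) = min (d x y) C"

definition augment :: "real \<Rightarrow> ('a \<Rightarrow> real) \<Rightarrow> 'a option \<Rightarrow> real" where
  "augment B \<mu> = case_option (B - mass X \<mu>) \<mu>"

lemma sum_aug_space: "sum f aug_space = f None + (\<Sum>x\<in>X. f (Some x))"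
  by (simp add: aug_space_def sum.insert[OF finite_imageI[OF finite_X]] sum.reindex comp_def)

lemma finite_aug_space: "finite aug_space"
  by (simp add: aug_space_def finite_X)

lemma aug_space_cases:
  assumes "s \<in> aug_space"
  obtains "s = None" | x where "x \<in> X" "s = Some x"
  using assms by (auto simp: aug_space_def)

lemma aug_dist_nonneg: "0 < C \<Longrightarrow> 0 \<le> aug_dist C s t"
  by (cases "(C, s, t)" rule: aug_dist.cases) auto

lemma aug_dist_None_powr: "0 < C \<Longrightarrow> (C / 2 powr (1 / p)) powr p = C powr p / 2"
  using p_ge_1 by (simp add: powr_divide powr_powr)

lemma aug_dist_triangle:
  assumes C: "0 < C" and st: "s \<in> aug_space" "t \<in> aug_space" "u \<in> aug_space"
  shows "aug_dist C s u \<le> aug_dist C s t + aug_dist C t u"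
proof -
  have "2 powr (1 / p) \<le> 2 powr 1" using p_ge_1 by (intro powr_mono) auto
  then have "C * 2 powr (1 / p) \<le> 2 * C" using C by simp
  \<comment> \<open>The critical case is the detour from one point of \<open>X\<close> to another
    through \<open>None\<close>, which must be no shorter than the cap \<open>C\<close>;
    \<open>p \<ge> 1\<close> enters here.\<close>
  then have half: "C \<le> C / 2 powr (1 / p) + C / 2 powr (1 / p)"
    by (simp add: field_simps)
  have "0 \<le> C / 2 powr (1 / p)" using C by simp
  note facts = this half C
  have tri: "min (d x z) C \<le> min (d x y) C + min (d y z) C" if "x \<in> X" "y \<in> X" "z \<in> X" for x y z
    using triangle[OF that] nonneg[of x y] nonneg[of y z] C by linarith
  have pos: "0 \<le> min (d x y) C" "min (d x y) C \<le> C" for x y using C by auto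
  show ?thesis
    using st(1)
  proof (cases rule: aug_space_cases)
    case 1
    show ?thesis
      using st(2)
    proof (cases rule: aug_space_cases)
      case 1
      then show ?thesis using \<open>s = None\<close> by simp
    next
      case (2 y)
      show ?thesis
        using st(3) by (cases rule: aug_space_cases) (use \<open>s = None\<close> 2 facts pos in auto)
    qed
  next
    case (2 x)
    note x = this
    show ?thesis
      using st(2)
    proof (cases rule: aug_space_cases)
      case 1
      show ?thesis
        using st(3) by (cases rule: aug_space_cases)
          (use x 1 facts in \<open>auto intro: min.coboundedI2\<close>)
    next
      case (2 y)
      show ?thesis
        using st(3) by (cases rule: aug_space_cases) (use x 2 facts pos tri in auto)
    qed
  qed
qed

lemma augmented_coupling:
  assumes C: "0 < C" and \<pi>: "\<pi> \<in> sub_couplings X \<mu> \<nu>"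
    and B: "mass X \<mu> + mass X \<nu> \<le> B"
  obtains \<pi>' where "\<pi>' \<in> couplings aug_space (augment B \<mu>) (augment B \<nu>)"
    "transport_cost aug_space (aug_dist C) p \<pi>' \<le> plan_cost X d p C \<mu> \<nu> \<pi>"
proof
  \<comment> \<open>Unmatched mass of \<open>\<mu>\<close> goes to the reservoir and unmatched mass
    of \<open>\<nu>\<close> comes from it. The entry at \<open>(None, None)\<close> is then forced
    by the marginals, and the lower bound on \<open>B\<close> makes it nonnegative.\<close>
  define f where "f s t = (case s of
      None \<Rightarrow> (case t of None \<Rightarrow> B - mass X \<mu> - mass X \<nu> + mass (X \<times> X) \<pi>
                       | Some y \<Rightarrow> \<nu> y - marginal2 X \<pi> y)
    | Some x \<Rightarrow> (case t of None \<Rightarrow> \<mu> x - marginal1 X \<pi> x | Some y \<Rightarrow> \<pi> (x, y)))" for s t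
  note nn = sub_couplings_nonneg[OF \<pi>]
  have le: "marginal1 X \<pi> x \<le> \<mu> x" "marginal2 X \<pi> x \<le> \<nu> x" if "x \<in> X" for x
    using \<pi> that by (auto simp: sub_couplings_def)
  have pos: "0 \<le> mass (X \<times> X) \<pi>"
    unfolding mass_times using nn by (intro sum_nonneg) auto
  have sums: "(\<Sum>x\<in>X. \<mu> x - marginal1 X \<pi> x) = mass X \<mu> - mass (X \<times> X) \<pi>"
    "(\<Sum>x\<in>X. \<nu> x - marginal2 X \<pi> x) = mass X \<nu> - mass (X \<times> X) \<pi>"
    unfolding mass_marginal1[of X \<pi>] by (simp add: mass_def[of X] sum_subtractf)
      (simp add: mass_marginal1[symmetric] mass_marginal2 mass_def[of X] sum_subtractf)
  show "plan aug_space f \<in> couplings aug_space (augment B \<mu>) (augment B \<nu>)"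
  proof (rule plan_in_couplings)
    show "0 \<le> f s t" if "s \<in> aug_space" "t \<in> aug_space" for s t
      using that le nn B pos by (auto simp: f_def aug_space_def)
    show "(\<Sum>t\<in>aug_space. f s t) = augment B \<mu> s" if "s \<in> aug_space" for s
      using that by (cases rule: aug_space_cases)
        (simp_all add: sum_aug_space f_def augment_def sums marginal1_def)
    show "(\<Sum>s\<in>aug_space. f s t) = augment B \<nu> t" if "t \<in> aug_space" for t
      using that by (cases rule: aug_space_cases)
        (simp_all add: sum_aug_space f_def augment_def sums marginal2_def)
  qed
  have "transport_cost aug_space (aug_dist C) p (plan aug_space f)
      = (\<Sum>y\<in>X. C powr p / 2 * (\<nu> y - marginal2 X \<pi> y))
        + (\<Sum>x\<in>X. C powr p / 2 * (\<mu> x - marginal1 X \<pi> x))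
        + (\<Sum>x\<in>X. \<Sum>y\<in>X. min (d x y) C powr p * \<pi> (x, y))"
    unfolding transport_cost_plan
    by (simp add: sum_aug_space f_def aug_dist_None_powr[OF C] sum.distrib)
  also have "\<dots> = C powr p * ((mass X \<mu> + mass X \<nu>) / 2 - mass (X \<times> X) \<pi>)
        + (\<Sum>x\<in>X. \<Sum>y\<in>X. min (d x y) C powr p * \<pi> (x, y))"
    unfolding sum_distrib_left[symmetric] sums by (simp add: field_simps)
  also have "(\<Sum>x\<in>X. \<Sum>y\<in>X. min (d x y) C powr p * \<pi> (x, y)) \<le> transport_cost X d p \<pi>"
    unfolding transport_cost_def using nn C p_ge_1
    by (intro sum_mono mult_right_mono powr_mono2) auto
  finally show "transport_cost aug_space (aug_dist C) p (plan aug_space f) \<le> plan_cost X d p C \<mu> \<nu> \<pi>"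
    by (simp add: plan_cost_def)
qed

text \<open>
  Mass that a coupling of the augmented measures moves further than \<open>C\<close> is dropped: destroying and
  recreating it costs exactly the \<open>C powr p\<close> per unit that the capped distance charges.
\<close>

lemma restricted_coupling:
  assumes C: "0 < C" and \<pi>: "\<pi> \<in> couplings aug_space (augment B \<mu>) (augment B \<nu>)"
  obtains \<pi>' where "\<pi>' \<in> sub_couplings X \<mu> \<nu>"
    "plan_cost X d p C \<mu> \<nu> \<pi>' \<le> transport_cost aug_space (aug_dist C) p \<pi>"
proof
  have nn: "0 \<le> \<pi> (Some x, Some y)" "0 \<le> \<pi> (Some x, None)" "0 \<le> \<pi> (None, Some x)"
    if "x \<in> X" "y \<in> X" for x y
    using couplings_nonneg[OF \<pi>] that by (auto simp: aug_space_def)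
  have m1: "\<pi> (Some x, None) + (\<Sum>y\<in>X. \<pi> (Some x, Some y)) = \<mu> x"
    and m2: "\<pi> (None, Some x) + (\<Sum>y\<in>X. \<pi> (Some y, Some x)) = \<nu> x" if "x \<in> X" for x
  proof -
    have "Some x \<in> aug_space" using that by (simp add: aug_space_def)
    then have "marginal1 aug_space \<pi> (Some x) = \<mu> x" "marginal2 aug_space \<pi> (Some x) = \<nu> x"
      using \<pi> by (auto simp: couplings_def augment_def)
    then show "\<pi> (Some x, None) + (\<Sum>y\<in>X. \<pi> (Some x, Some y)) = \<mu> x"
      "\<pi> (None, Some x) + (\<Sum>y\<in>X. \<pi> (Some y, Some x)) = \<nu> x"
      by (simp_all add: marginal1_def marginal2_def sum_aug_space)
  qed
  define f where "f x y = (if d x y \<le> C then \<pi> (Some x, Some y) else 0)" for x y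
  define S where "S = (\<Sum>x\<in>X. \<Sum>y\<in>X. \<pi> (Some x, Some y))"
  have f: "0 \<le> f x y" "f x y \<le> \<pi> (Some x, Some y)" if "x \<in> X" "y \<in> X" for x y
    using nn that by (auto simp: f_def)
  show "plan X f \<in> sub_couplings X \<mu> \<nu>"
  proof (rule plan_in_sub_couplings)
    show "(\<Sum>y\<in>X. f x y) \<le> \<mu> x" if "x \<in> X" for x
    proof -
      have "(\<Sum>y\<in>X. f x y) \<le> (\<Sum>y\<in>X. \<pi> (Some x, Some y))"
        using that f by (intro sum_mono) auto
      then show ?thesis using m1[OF that] nn(2)[OF that that] by linarith
    qed
    show "(\<Sum>x\<in>X. f x y) \<le> \<nu> y" if "y \<in> X" for y
    proof -
      have "(\<Sum>x\<in>X. f x y) \<le> (\<Sum>x\<in>X. \<pi> (Some x, Some y))"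
        using that f by (intro sum_mono) auto
      then show ?thesis using m2[OF that] nn(3)[OF that that] by linarith
    qed
  qed (use f in auto)
  have out: "(\<Sum>x\<in>X. \<pi> (Some x, None)) = mass X \<mu> - S"
    unfolding S_def mass_def by (simp add: m1[symmetric] sum.distrib)
  have "S = (\<Sum>y\<in>X. \<Sum>x\<in>X. \<pi> (Some x, Some y))" unfolding S_def by (rule sum.swap)
  then have inn: "(\<Sum>x\<in>X. \<pi> (None, Some x)) = mass X \<nu> - S"
    unfolding mass_def by (simp add: m2[symmetric] sum.distrib)
  have "transport_cost aug_space (aug_dist C) p \<pi>
      = (\<Sum>y\<in>X. C powr p / 2 * \<pi> (None, Some y)) + (\<Sum>x\<in>X. C powr p / 2 * \<pi> (Some x, None))
        + (\<Sum>x\<in>X. \<Sum>y\<in>X. min (d x y) C powr p * \<pi> (Some x, Some y))"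
    unfolding transport_cost_def
    by (simp add: sum_aug_space aug_dist_None_powr[OF C] sum.distrib)
  also have "\<dots> = C powr p * ((mass X \<mu> + mass X \<nu>) / 2 - S)
        + (\<Sum>x\<in>X. \<Sum>y\<in>X. min (d x y) C powr p * \<pi> (Some x, Some y))"
    unfolding sum_distrib_left[symmetric] out inn by (simp add: field_simps)
  \<comment> \<open>Every entry is kept or dropped as a whole. The \<open>C powr p\<close> charged
    for the dropped part turns \<open>S\<close> into the mass of the restricted plan in the
    penalty.\<close>
  also have "(\<Sum>x\<in>X. \<Sum>y\<in>X. min (d x y) C powr p * \<pi> (Some x, Some y))
      = (\<Sum>x\<in>X. \<Sum>y\<in>X. d x y powr p * f x y + C powr p * (\<pi> (Some x, Some y) - f x y))"
    by (intro sum.cong refl) (auto simp: f_def min_def)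
  also have "\<dots> = transport_cost X d p (plan X f) + C powr p * (S - mass (X \<times> X) (plan X f))"
    by (simp add: transport_cost_plan mass_plan S_def sum.distrib sum_subtractf
        sum_distrib_left[symmetric])
  finally show "plan_cost X d p C \<mu> \<nu> (plan X f) \<le> transport_cost aug_space (aug_dist C) p \<pi>"
    by (simp add: plan_cost_def algebra_simps)
qed

section \<open>The metric axioms\<close>

lemma KR_triangle:
  assumes C: "0 < C" and \<mu>: "\<mu> \<in> nonneg_measures X" and \<nu>: "\<nu> \<in> nonneg_measures X"
    and \<xi>: "\<xi> \<in> nonneg_measures X"
  shows "KR X d p C \<mu> \<xi> \<le> KR X d p C \<mu> \<nu> + KR X d p C \<nu> \<xi>"
proof (rule field_le_epsilon)
  fix \<epsilon> :: real assume "0 < \<epsilon>"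
  \<comment> \<open>Gluing needs strictly positive cost bounds; the slack
    \<open>\<epsilon> / 2\<close> provides them even when a distance is 0.\<close>
  define A where "A = KR X d p C \<mu> \<nu> + \<epsilon> / 2"
  define A' where "A' = KR X d p C \<nu> \<xi> + \<epsilon> / 2"
  have KR_nonneg: "0 \<le> KR X d p C \<alpha> \<beta>" for \<alpha> \<beta> by (simp add: KR_def)
  have A: "0 < A" "0 < A'"
    using \<open>0 < \<epsilon>\<close> KR_nonneg by (auto simp: A_def A'_def intro!: add_nonneg_pos)
  \<comment> \<open>One total mass for all three measures, large enough for both pairs, so that the
    two couplings share the marginal \<open>augment B \<nu>\<close>.\<close>
  define B where "B = mass X \<mu> + mass X \<nu> + mass X \<xi>"
  have mass_nonneg: "0 \<le> mass X \<mu>" "0 \<le> mass X \<xi>"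
    unfolding mass_def using nonneg_measuresD[OF \<mu>] nonneg_measuresD[OF \<xi>]
    by (auto intro: sum_nonneg)
  then have B: "mass X \<mu> + mass X \<nu> \<le> B" "mass X \<nu> + mass X \<xi> \<le> B"
    by (simp_all add: B_def)
  obtain \<pi>1 where \<pi>1: "\<pi>1 \<in> sub_couplings X \<mu> \<nu>" "UOT X d p C \<mu> \<nu> = plan_cost X d p C \<mu> \<nu> \<pi>1"
    using optimal_plan[OF \<mu> \<nu>] by blast
  obtain \<pi>2 where \<pi>2: "\<pi>2 \<in> sub_couplings X \<nu> \<xi>" "UOT X d p C \<nu> \<xi> = plan_cost X d p C \<nu> \<xi> \<pi>2"
    using optimal_plan[OF \<nu> \<xi>] by blast
  have le: "UOT X d p C \<mu> \<nu> \<le> A powr p" "UOT X d p C \<nu> \<xi> \<le> A' powr p"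
    unfolding KR_powr[OF \<mu> \<nu>, symmetric] KR_powr[OF \<nu> \<xi>, symmetric]
    using \<open>0 < \<epsilon>\<close> p_ge_1 KR_nonneg by (auto simp: A_def A'_def intro!: powr_mono2)
  obtain \<rho>1 where \<rho>1: "\<rho>1 \<in> couplings aug_space (augment B \<mu>) (augment B \<nu>)"
      "transport_cost aug_space (aug_dist C) p \<rho>1 \<le> A powr p"
    using augmented_coupling[OF C \<pi>1(1) B(1)] order_trans[OF _ le(1)[unfolded \<pi>1(2)]] by blast
  obtain \<rho>2 where \<rho>2: "\<rho>2 \<in> couplings aug_space (augment B \<nu>) (augment B \<xi>)"
      "transport_cost aug_space (aug_dist C) p \<rho>2 \<le> A' powr p"
    using augmented_coupling[OF C \<pi>2(1) B(2)] order_trans[OF _ le(2)[unfolded \<pi>2(2)]] by blast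
  obtain \<rho> where \<rho>: "\<rho> \<in> couplings aug_space (augment B \<mu>) (augment B \<xi>)"
      "transport_cost aug_space (aug_dist C) p \<rho> \<le> (A + A') powr p"
    using glued_coupling[OF finite_aug_space p_ge_1 aug_dist_nonneg[OF C] aug_dist_triangle[OF C]
        \<rho>1(1) \<rho>2(1) A \<rho>1(2) \<rho>2(2)] by blast
  obtain \<pi> where \<pi>: "\<pi> \<in> sub_couplings X \<mu> \<xi>" "plan_cost X d p C \<mu> \<xi> \<pi> \<le> (A + A') powr p"
    using restricted_coupling[OF C \<rho>(1)] order_trans[OF _ \<rho>(2)] by blast
  have "UOT X d p C \<mu> \<xi> \<le> (A + A') powr p"
    using UOT_le[OF \<mu> \<xi> \<pi>(1)] \<pi>(2) by (rule order_trans)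
  then have "KR X d p C \<mu> \<xi> \<le> ((A + A') powr p) powr (1 / p)"
    unfolding KR_def using UOT_nonneg[OF \<mu> \<xi>] p_ge_1 by (intro powr_mono2) auto
  also have "\<dots> = A + A'" using A p_ge_1 by (simp add: powr_powr)
  finally show "KR X d p C \<mu> \<xi> \<le> KR X d p C \<mu> \<nu> + KR X d p C \<nu> \<xi> + \<epsilon>"
    by (simp add: A_def A'_def)
qed

lemma KR_eq_0_iff:
  assumes C: "0 < C" and \<mu>: "\<mu> \<in> nonneg_measures X" and \<nu>: "\<nu> \<in> nonneg_measures X"
  shows "KR X d p C \<mu> \<nu> = 0 \<longleftrightarrow> \<mu> = \<nu>"
proof
  assume "KR X d p C \<mu> \<nu> = 0"
  then have zero: "UOT X d p C \<mu> \<nu> = 0" by (simp add: KR_def)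
  \<comment> \<open>Including \<open>C\<close> keeps the set nonempty when \<open>X\<close> has
    fewer than two points and gives \<open>Min D \<le> C\<close>, as monotonicity in
    \<open>C\<close> requires.\<close>
  define D where "D = insert C ((\<lambda>(x, y). d x y) ` {(x, y) \<in> X \<times> X. x \<noteq> y})"
  have "finite D"
    by (rule finite_subset[of _ "insert C ((\<lambda>(x, y). d x y) ` (X \<times> X))"])
      (auto simp: D_def finite_X)
  then have D: "finite D" "D \<noteq> {}" by (simp_all add: D_def)
  have "\<forall>c\<in>D. 0 < c" using C mdist_pos_less by (auto simp: D_def)
  then have pos: "0 < Min D" using D by simp
  have "Min D powr p / 2 * TV X \<mu> \<nu> \<le> UOT X d p (Min D) \<mu> \<nu>"
    by (rule UOT_ge_TV_small[OF \<mu> \<nu> pos]) (use D in \<open>auto simp: D_def intro!: Min_le\<close>)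
  also have "\<dots> \<le> UOT X d p C \<mu> \<nu>"
    using D by (intro UOT_mono[OF \<mu> \<nu> pos] Min_le) (auto simp: D_def)
  finally have "TV X \<mu> \<nu> \<le> 0" using zero pos by (simp add: mult_le_0_iff)
  then have "(\<Sum>x\<in>X. \<bar>\<mu> x - \<nu> x\<bar>) = 0" unfolding TV_def by (intro antisym sum_nonneg) auto
  then have "\<forall>x\<in>X. \<mu> x = \<nu> x" by (simp add: sum_nonneg_eq_0_iff[OF finite_X])
  with \<mu> \<nu> show "\<mu> = \<nu>" unfolding nonneg_measures_def by (blast intro: PiE_ext)
next
  assume "\<mu> = \<nu>"
  then have "UOT X d p C \<mu> \<nu> = 0"
    using UOT_le_TV[OF \<mu> \<nu>, of C] UOT_nonneg[OF \<mu> \<nu>, of C] by (simp add: TV_def)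
  then show "KR X d p C \<mu> \<nu> = 0" by (simp add: KR_def)
qed

lemma Metric_space_KR:
  assumes "0 < C"
  shows "Metric_space (nonneg_measures X) (KR X d p C)"
proof
  show "0 \<le> KR X d p C \<mu> \<nu>" for \<mu> \<nu> by (simp add: KR_def)
  show "KR X d p C \<mu> \<nu> = KR X d p C \<nu> \<mu>" for \<mu> \<nu> by (simp add: KR_def UOT_commute[of C \<mu> \<nu>])
qed (use assms KR_eq_0_iff KR_triangle in auto)

end

theorem theorem2p2:
  fixes X :: "'a set" and d :: "'a \<Rightarrow> 'a \<Rightarrow> real" and p :: real
  assumes "Metric_space X d" and "finite X" and "p \<ge> 1"
  shows
    "(\<forall>C>0. Metric_space (nonneg_measures X) (KR X d p C))
     \<and> (\<forall>C>0. (\<forall>x\<in>X. \<forall>x'\<in>X. x \<noteq> x' \<longrightarrow> C \<le> d x x') \<longrightarrow>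
          (\<forall>\<mu>\<in>nonneg_measures X. \<forall>\<nu>\<in>nonneg_measures X.
             KR X d p C \<mu> \<nu> powr p = C powr p / 2 * TV X \<mu> \<nu>))
     \<and> (\<forall>C>0. \<forall>\<mu>\<in>nonneg_measures X. \<forall>\<nu>\<in>nonneg_measures X.
          (\<forall>x\<in>X. \<mu> x \<ge> \<nu> x) \<or> (\<forall>x\<in>X. \<mu> x \<le> \<nu> x) \<longrightarrow>
             KR X d p C \<mu> \<nu> powr p = C powr p / 2 * TV X \<mu> \<nu>)
     \<and> (\<forall>C>0. (\<forall>x\<in>X. \<forall>x'\<in>X. d x x' \<le> C) \<longrightarrow>
          (\<forall>\<mu>\<in>nonneg_measures X. \<forall>\<nu>\<in>nonneg_measures X.
             mass X \<mu> = mass X \<nu> \<longrightarrow>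
               KR X d p C \<mu> \<nu> powr p = Wasserstein X d p \<mu> \<nu> powr p))
     \<and> (\<forall>C1 C2. 0 < C1 \<and> C1 \<le> C2 \<longrightarrow>
          (\<forall>\<mu>\<in>nonneg_measures X. \<forall>\<nu>\<in>nonneg_measures X.
             KR X d p C1 \<mu> \<nu> powr p \<le> KR X d p C2 \<mu> \<nu> powr p))"
proof -
  interpret finite_transport X d p
    using assms by (simp add: finite_transport_def finite_transport_axioms_def)
  have "KR X d p C \<mu> \<nu> powr p = C powr p / 2 * TV X \<mu> \<nu>"
    if "0 < C" "\<forall>x\<in>X. \<forall>x'\<in>X. x \<noteq> x' \<longrightarrow> C \<le> d x x'"
      "\<mu> \<in> nonneg_measures X" "\<nu> \<in> nonneg_measures X" for C \<mu> \<nu>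
    using UOT_le_TV[OF that(3,4)] UOT_ge_TV_small[OF that(3,4,1)] that
    by (simp add: KR_powr antisym)
  moreover have "KR X d p C \<mu> \<nu> powr p = C powr p / 2 * TV X \<mu> \<nu>"
    if "\<mu> \<in> nonneg_measures X" "\<nu> \<in> nonneg_measures X"
      "(\<forall>x\<in>X. \<mu> x \<ge> \<nu> x) \<or> (\<forall>x\<in>X. \<mu> x \<le> \<nu> x)" for C \<mu> \<nu>
    using UOT_le_TV[OF that(1,2)] UOT_ge_TV_ordered[OF that] that
    by (simp add: KR_powr antisym)
  moreover have "KR X d p C \<mu> \<nu> powr p = Wasserstein X d p \<mu> \<nu> powr p"
    if "\<forall>x\<in>X. \<forall>x'\<in>X. d x x' \<le> C" "\<mu> \<in> nonneg_measures X" "\<nu> \<in> nonneg_measures X"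
      "mass X \<mu> = mass X \<nu>" for C \<mu> \<nu>
    using UOT_eq_Wasserstein[OF that(2-4)] that by (simp add: KR_powr)
  ultimately show ?thesis
    using Metric_space_KR UOT_mono KR_powr by (intro conjI) simp_all
qed

end
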